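(* Let $n\ge 2$ be a fixed integer, and consider the $n$-ary elliptic ring $n\mathrm{Ell}(\mathbb{Z})$ with its norm $\Sigma_n(a)=1-(n+1)a$. The $\circ_n$-primes are exactly the classical primes $p\in\mathbb{Z}$ with $|\Sigma_n(p)|\equiv\pm1\pmod{n+1}$. Moreover, the following are equivalent: (i) There are infinitely many $\circ_n$-prime elements in $n\mathrm{Ell}(\mathbb{Z})$. (ii) There are infinitely many classical primes $p\equiv\pm1\pmod{n+1}$. Part (ii) is Dirichlet's theorem for $\pm1+(n+1)\mathbb{Z}$, and consequently there are infinitely many $\circ_n$-primes in $n\mathrm{Ell}(\mathbb{Z})$.
   Context: $n\mathrm{Ell}(\mathbb{Z})$ is the set $\mathbb{Z}$ with the $n$-ary operation $a_1\ast_n\cdots\ast_n a_n:=1-\sum_{i=1}^n a_i$ and the commutative monoid operation $a\circ_n b:=a+b-(n+1)ab$, whose identity is $0$. The norm is the map $\Sigma_n:\mathbb{Z}\to\mathbb{Z}$, $\Sigma_n(a):=1-(n+1)a$. A $\circ_n$-unit is an element $u$ for which there is $v$ with $u\circ_n v=0$. An $n$-ary ideal is a subset $I\subseteq\mathbb{Z}$ closed under $\ast_n$ and such that $a\circ_n r\in I$ for all $a\in\mathbb{Z}$, $r\in I$; the principal ideal of $a$ is $(a):=\{a\circ_n r: r\in\mathbb{Z}\}$. An $n$-ary ideal $\mathfrak{p}\subsetneq\mathbb{Z}$ is $\circ_n$-prime if $a\circ_n b\in\mathfrak{p}$ implies $a\in\mathfrak{p}$ or $b\in\mathfrak{p}$.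 An element $p$ is $\circ_n$-prime if it is not a $\circ_n$-unit and $(p)$ is a $\circ_n$-prime ideal. A classical prime is an ordinary prime number in $\mathbb{Z}$.
   Formalization: Primality is required of |Σ_n(p)|, not of p: p is ∘_n-prime iff |Σ_n(p)| is a classical prime (≡ ±1 mod n+1), and |Σ_n| is a bijection onto the classical primes ≡ ±1. The literal claim fails: for n=2, p=5 is not ∘_2-prime, while p=4 is. *)

theory Defs
  imports "HOL-Number_Theory.Number_Theory"
begin

text \<open>
  The \<open>n\<close>-ary elliptic ring on \<^typ>\<open>int\<close>. An \<open>n\<close>-tuple of arguments is the restriction of a
  function \<^typ>\<open>nat \<Rightarrow> int\<close> to the indices \<open>1, \<dots>, n\<close>; values at other indices are ignored.
\<close>

definition ell_add :: "nat \<Rightarrow> (nat \<Rightarrow> int) \<Rightarrow> int" where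
  "ell_add n a = 1 - (\<Sum>i=1..n. a i)"

definition ell_mult :: "nat \<Rightarrow> int \<Rightarrow> int \<Rightarrow> int" where
  "ell_mult n a b = a + b - (int n + 1) * a * b"

definition ell_norm :: "nat \<Rightarrow> int \<Rightarrow> int" where
  "ell_norm n a = 1 - (int n + 1) * a"

definition ell_unit :: "nat \<Rightarrow> int \<Rightarrow> bool" where
  "ell_unit n u \<longleftrightarrow> (\<exists>v. ell_mult n u v = 0)"

definition ell_ideal :: "nat \<Rightarrow> int set \<Rightarrow> bool" where
  "ell_ideal n I \<longleftrightarrow>
     (\<forall>a. (\<forall>i\<in>{1..n}. a i \<in> I) \<longrightarrow> ell_add n a \<in> I) \<and>
     (\<forall>a. \<forall>r\<in>I. ell_mult n a r \<in> I)"

definition ell_principal :: "nat \<Rightarrow> int \<Rightarrow> int set" where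
  "ell_principal n a = {ell_mult n a r | r. True}"

definition ell_prime_ideal :: "nat \<Rightarrow> int set \<Rightarrow> bool" where
  "ell_prime_ideal n P \<longleftrightarrow>
     ell_ideal n P \<and> P \<subset> UNIV \<and>
     (\<forall>a b. ell_mult n a b \<in> P \<longrightarrow> a \<in> P \<or> b \<in> P)"

definition ell_prime :: "nat \<Rightarrow> int \<Rightarrow> bool" where
  "ell_prime n p \<longleftrightarrow> \<not> ell_unit n p \<and> ell_prime_ideal n (ell_principal n p)"

definition cong_pm1 :: "int \<Rightarrow> int \<Rightarrow> bool" where
  "cong_pm1 m x \<longleftrightarrow> [x = 1] (mod m) \<or> [x = -1] (mod m)"

end

theory Submission
  imports Defs "HOL-Computational_Algebra.Polynomial_Factorial"
begin

text \<open>
  Write \<open>m = n + 1\<close>. The norm \<open>\<Sigma>\<^sub>n(a) = 1 - m a\<close> turns \<open>\<circ>\<^sub>n\<close> into ordinary multiplication and maps the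
  integers bijectively onto the residue class \<open>1 + m\<int>\<close>. Hence \<open>n\<close>-ary divisibility is ordinary
  divisibility of norms: if \<open>\<Sigma>\<^sub>n(p) * k = \<Sigma>\<^sub>n(x)\<close> then \<open>k\<close> is forced into \<open>1 + m\<int>\<close>, so it is itself a
  norm (\<open>ell_principal_iff\<close>). An element whose norm is prime up to sign is therefore \<open>\<circ>\<^sub>n\<close>-prime.
  Conversely, a \<open>\<circ>\<^sub>n\<close>-prime only tests divisibility by \<open>\<Sigma>\<^sub>n(p)\<close> on products of elements of \<open>1 + m\<int>\<close>;
  but \<open>\<Sigma>\<^sub>n(p)\<close> is coprime to \<open>m\<close>, so by the Chinese remainder theorem every residue class modulo
  \<open>\<Sigma>\<^sub>n(p)\<close> contains a norm, and \<open>\<Sigma>\<^sub>n(p)\<close> is prime in the usual sense (\<open>ell_prime_iff_prime_norm\<close>).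

  An integer \<open>q \<ge> 0\<close> with \<open>q \<equiv> \<plusminus>1\<close> modulo \<open>m\<close> is the absolute value of a norm, and only of one because
  \<open>1\<close> and \<open>-1\<close> are distinct modulo \<open>m \<ge> 3\<close>. This gives the bijection between the \<open>\<circ>\<^sub>n\<close>-primes
  and the classical primes congruent to \<open>\<plusminus>1\<close>.

  That the latter are infinite in number already holds for the class of \<open>1\<close>, where Dirichlet's
  theorem has an algebraic proof. Let \<open>D\<close> be the prime factor of \<open>X\<^sup>m - 1\<close> in \<open>\<int>[X]\<close> that vanishes at
  a primitive \<open>m\<close>-th root of unity (the cyclotomic polynomial up to sign). If a prime \<open>q\<close> divides
  \<open>D(a)\<close> but neither \<open>m\<close> nor \<open>a\<close>, then \<open>a\<close> has order exactly \<open>m\<close> modulo \<open>q\<close>, whence \<open>m\<close> divides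
  \<open>q - 1\<close> (\<open>cyclotomic_prime_divisor_cong_1\<close>). Since \<open>D(0) = \<plusminus>1\<close>, the prime factors of \<open>D(a)\<close> do
  not divide \<open>a\<close>; choosing \<open>a\<close> divisible by \<open>m\<close> and \<open>b!\<close> makes them exceed a given bound \<open>b\<close>.
\<close>

section \<open>Infinitely many primes congruent to one\<close>

lemma map_poly_of_int_mult:
  "map_poly of_int (p * q) = (map_poly of_int p * map_poly of_int q :: 'a :: {ring_char_0, comm_ring_1} poly)"
  by (rule poly_eqI) (simp add: coeff_map_poly coeff_mult)

lemma primitive_root_of_unity_power:
  assumes "0 < d" "d < n"
  shows "cis (2 * pi / real n) ^ d \<noteq> 1"
proof
  assume eq: "cis (2 * pi / real n) ^ d = 1"
  have "inj_on (\<lambda>k. cis (2 * pi * real k / real n)) {..<n}"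
    using bij_betw_roots_unity[of n] assms by (simp add: bij_betw_def)
  moreover have "cis (2 * pi * real d / real n) = cis (2 * pi * real 0 / real n)"
    using eq by (simp add: DeMoivre mult_ac)
  ultimately have "d = 0"
    by (rule inj_onD) (use assms in auto)
  with assms show False by simp
qed

text \<open>
  Evaluation at a primitive \<open>n\<close>-th root of unity kills \<open>X\<^sup>n - 1\<close>, hence one of its prime factors in
  the factorial ring \<open>\<int>[X]\<close>, but no \<open>X\<^sup>d - 1\<close> with \<open>0 < d < n\<close>, so none of these is a multiple of
  that factor. Taking a prime of \<open>\<int>[X]\<close> rather than of \<open>\<rat>[X]\<close> keeps every later divisibility
  valid after substituting an integer, with no denominators to clear.
\<close>
lemma cyclotomic_prime_factor_exists:
  fixes n :: nat
  assumes "n > 0"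
  obtains D :: "int poly" where "prime_elem D" "D dvd monom 1 n - 1"
    "\<And>d. 0 < d \<Longrightarrow> d < n \<Longrightarrow> \<not> D dvd monom 1 d - 1"
proof -
  define \<zeta> where "\<zeta> = cis (2 * pi / real n)"
  define e where "e = (\<lambda>p :: int poly. poly (map_poly of_int p) \<zeta>)"
  have e_mult: "e (p * q) = e p * e q" for p q
    by (simp add: e_def map_poly_of_int_mult)
  have e_dvd: "e q = 0" if "p dvd q" "e p = 0" for p q
    using that by (auto simp: e_mult elim!: dvdE)
  have e_monom: "e (monom 1 d - 1) = \<zeta> ^ d - 1" for d
  proof -
    have "map_poly of_int (monom 1 d - 1 :: int poly) = (monom 1 d - 1 :: complex poly)"
      by (rule poly_eqI) (simp add: coeff_map_poly)
    then show ?thesis by (simp add: e_def poly_monom)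
  qed
  have "\<zeta> ^ n = 1"
    using assms by (simp add: \<zeta>_def DeMoivre)
  then have root: "e (monom 1 n - 1) = 0"
    by (simp add: e_monom)
  have "coeff (monom 1 n - 1 :: int poly) 0 = -1"
    using assms by simp
  then have "monom 1 n - 1 \<noteq> (0 :: int poly)"
    by (metis coeff_0 neg_equal_0_iff_equal zero_neq_one)
  then obtain A where A: "\<And>D. D \<in># A \<Longrightarrow> prime D"
      "normalize (prod_mset A) = normalize (monom 1 n - 1 :: int poly)"
    by (rule prime_factorization_exists') blast
  have "e (prod_mset A) = 0"
    using root A(2) by (metis associated_iff_dvd e_dvd)
  then have "\<exists>D\<in>#A. e D = 0"
    by (induction A) (auto simp: e_mult, simp add: e_def)
  then obtain D where D: "D \<in># A" "e D = 0" by blast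
  show ?thesis
  proof (rule that)
    show "prime_elem D" using A(1) D(1) by (simp add: prime_imp_prime_elem)
    show "D dvd monom 1 n - 1"
      using A(2) D(1) by (metis associated_iff_dvd dvd_prod_mset dvd_trans)
    show "\<not> D dvd monom 1 d - 1" if "0 < d" "d < n" for d
      using e_dvd[OF _ D(2), of "monom 1 d - 1"] primitive_root_of_unity_power[OF that]
      by (auto simp: e_monom \<zeta>_def)
  qed
qed

text \<open>
  The order of \<open>a\<close> modulo \<open>q\<close> divides \<open>n\<close>. Were it a proper divisor, it would divide \<open>k = n / p\<close> for
  some prime \<open>p\<close>. But \<open>D\<close> divides \<open>X\<^sup>n - 1 = (X\<^sup>k - 1) B\<close> without dividing the first factor, so it
  divides \<open>B\<close>, the sum of the powers \<open>(X\<^sup>k)\<^sup>i\<close> over \<open>i < p\<close>. As \<open>a\<^sup>k \<equiv> 1\<close> makes \<open>B(a) \<equiv> p\<close>, the prime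
  \<open>q\<close> would divide \<open>p\<close> and so \<open>n\<close>.
\<close>
lemma cyclotomic_prime_divisor_cong_1:
  fixes D :: "int poly" and n q a :: nat
  assumes "n > 0" and D: "prime_elem D" "D dvd monom 1 n - 1"
    "\<And>d. 0 < d \<Longrightarrow> d < n \<Longrightarrow> \<not> D dvd monom 1 d - 1"
    and q: "prime q" "int q dvd poly D (int a)" "\<not> q dvd n" "\<not> q dvd a"
  shows "[q = 1] (mod n)"
proof -
  have cong_iff: "[a ^ d = 1] (mod q) \<longleftrightarrow> int q dvd int a ^ d - 1" for d
    by (metis cong_iff_dvd_diff cong_int_iff of_nat_1 of_nat_power)
  have "poly D (int a) dvd int a ^ n - 1"
    using D(2) by (auto simp: poly_monom elim!: dvdE)
       (metis dvd_triv_left poly_1 poly_diff poly_monom poly_mult mult_1)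
  then have "int q dvd int a ^ n - 1"
    using q(2) dvd_trans by blast
  then have ord_dvd: "ord q a dvd n"
    using cong_iff ord_divides by blast
  have not_dvd: "\<not> ord q a dvd n div p" if p: "prime p" "p dvd n" for p
  proof
    assume "ord q a dvd n div p"
    define k where "k = n div p"
    have n: "n = k * p" and k: "0 < k" "k < n"
      using p \<open>n > 0\<close> prime_gt_1_nat[of p] by (auto simp: k_def intro!: Nat.gr0I)
    define B where "B = (\<Sum>i<p. monom 1 k ^ i :: int poly)"
    have "monom 1 n - 1 = (monom 1 k - 1) * B"
      using power_diff_1_eq[of "monom 1 k :: int poly" p] p prime_gt_0_nat[of p]
      by (simp add: B_def n monom_power)
    then have "D dvd B"
      using D k by (metis prime_elem_dvd_mult_iff)
    then have "int q dvd poly B (int a)"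
      using q(2) by (metis dvd_def dvd_trans poly_mult)
    moreover have "poly B (int a) = (\<Sum>i<p. (int a ^ k) ^ i)"
      by (simp add: B_def poly_sum poly_monom)
    moreover have "[int a ^ k = 1] (mod int q)"
      using \<open>ord q a dvd n div p\<close> cong_iff ord_divides
      by (simp add: k_def cong_iff_dvd_diff)
    then have "[(\<Sum>i<p. (int a ^ k) ^ i) = (\<Sum>i<p. 1 ^ i)] (mod int q)"
      by (intro cong_sum cong_pow)
    ultimately have "int q dvd int p"
      by (simp add: cong_dvd_iff)
    then show False
      using q(3) p(2) by (meson dvd_trans int_dvd_int_iff)
  qed
  have "ord q a = n"
  proof (rule ccontr)
    obtain j where j: "n = ord q a * j"
      using ord_dvd by blast
    assume "ord q a \<noteq> n"
    with j have "j \<noteq> 1" by auto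
    then obtain p where p: "prime p" "p dvd j"
      using prime_factor_nat by blast
    then have "ord q a dvd n div p"
      using j by (metis dvd_triv_left div_mult_swap)
    with not_dvd[of p] p j show False by simp
  qed
  moreover have "ord q a dvd q - 1"
    using order_divides_totient[of q a] q by (simp add: prime_imp_coprime totient_prime)
  ultimately show ?thesis
    using q(1) prime_ge_1_nat[of q] by (metis cong_altdef_nat)
qed

text \<open>
  Euclid's argument for the values of \<open>D\<close>: as \<open>D\<close> divides \<open>X\<^sup>n - 1\<close>, its constant term is \<open>\<plusminus>1\<close>, so
  \<open>D(a)\<close> is coprime to \<open>a\<close>, and a multiple \<open>a\<close> of \<open>n N!\<close> excludes the prime divisors of \<open>n\<close> and all
  primes up to \<open>N\<close>.
\<close>
theorem infinite_primes_cong_1: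
  fixes n :: nat
  assumes "n > 0"
  shows "infinite {q. prime q \<and> [q = 1] (mod n)}"
proof -
  obtain D :: "int poly" where D: "prime_elem D" "D dvd monom 1 n - 1"
    "\<And>d. 0 < d \<Longrightarrow> d < n \<Longrightarrow> \<not> D dvd monom 1 d - 1"
    using cyclotomic_prime_factor_exists[OF assms] by blast
  have "poly D 0 dvd -1"
  proof -
    have "poly D 0 dvd poly (monom 1 n - 1) 0"
      using D(2) by (metis dvd_def poly_mult)
    then show ?thesis using assms by (simp add: poly_monom zero_power)
  qed
  then have D0: "\<bar>poly D 0\<bar> = 1" by simp
  have nonconst: "D \<noteq> [:c:]" for c
  proof
    assume c: "D = [:c:]"
    then have "c dvd 1" using D0 by auto
    then have "D dvd 1" using c by (simp add: is_unit_const_poly_iff)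
    then show False using D(1) by (simp add: prime_elem_def)
  qed
  have "\<exists>q>N. prime q \<and> [q = 1] (mod n)" for N
  proof -
    define M where "M = n * fact N"
    have "M > 0" using assms by (simp add: M_def)
    \<comment> \<open>As \<open>D\<close> is not constant, it takes the values \<open>0\<close> and \<open>\<plusminus>1\<close> only finitely often, so
      \<open>D(a)\<close> has a prime factor for some multiple \<open>a\<close> of \<open>M\<close>.\<close>
    have fin: "finite {x. poly D x = c}" for c
    proof -
      have "D - [:c:] \<noteq> 0" using nonconst[of c] by simp
      from poly_roots_finite[OF this] show ?thesis by simp
    qed
    have "finite {x. \<bar>poly D x\<bar> \<le> 1}"
    proof (rule finite_subset)
      show "{x. \<bar>poly D x\<bar> \<le> 1} \<subseteq> {x. poly D x = 0} \<union> {x. poly D x = 1} \<union> {x. poly D x = -1}"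
        by auto
    qed (simp add: fin)
    moreover have "infinite (range (\<lambda>k. int (M * k)))"
      using \<open>M > 0\<close> by (intro range_inj_infinite injI) simp
    ultimately obtain k where k: "\<bar>poly D (int (M * k))\<bar> > 1"
      by (metis (mono_tags, lifting) finite_subset image_subsetI mem_Collect_eq not_le)
    define a where "a = M * k"
    have "nat \<bar>poly D (int a)\<bar> \<noteq> 1" using k by (simp add: a_def)
    then obtain q where q: "prime q" "q dvd nat \<bar>poly D (int a)\<bar>"
      using prime_factor_nat by blast
    then have qD: "int q dvd poly D (int a)"
      by (simp add: dvd_nat_abs_iff)
    have "\<not> q dvd a"
    proof
      assume "q dvd a"
      obtain c E where "D = pCons c E" by (rule pCons_cases)
      then have "poly D (int a) = poly D 0 + int a * poly E (int a)" by simp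
      then have "int q dvd poly D 0"
        using qD \<open>q dvd a\<close> by (simp add: dvd_add_left_iff)
      then have "int q dvd 1" using D0 by (metis dvd_abs_iff)
      then show False using q(1) by simp
    qed
    moreover have "\<not> q dvd n" "\<not> q dvd fact N"
      using \<open>\<not> q dvd a\<close> by (auto simp: a_def M_def)
    moreover from this have "q > N"
      using q(1) by (simp add: prime_dvd_fact_iff)
    ultimately show ?thesis
      using cyclotomic_prime_divisor_cong_1[OF assms D q(1) qD] q(1) by blast
  qed
  then show ?thesis
    by (auto simp: infinite_nat_iff_unbounded)
qed

section \<open>The norm and the primes of the elliptic ring\<close>

lemma ell_norm_mult: "ell_norm n (ell_mult n a b) = ell_norm n a * ell_norm n b"
  by (simp add: ell_norm_def ell_mult_def algebra_simps)

text \<open>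
  The constant term \<open>1 - (n + 1) = -n\<close> on the left is exactly the sum of the constant terms of
  \<open>n\<close> negated norms. Having no constant term left over is why the multiples of a norm are closed
  under the \<open>n\<close>-ary addition.
\<close>
lemma ell_norm_add: "ell_norm n (ell_add n a) = - (\<Sum>i=1..n. ell_norm n (a i))"
  by (simp add: ell_norm_def ell_add_def sum_subtractf flip: sum_distrib_left)
     (simp add: algebra_simps)

lemma range_ell_norm: "x \<in> range (ell_norm n) \<longleftrightarrow> [x = 1] (mod int n + 1)"
proof
  assume "[x = 1] (mod int n + 1)"
  then obtain k where "1 - x = (int n + 1) * k"
    by (metis cong_iff_dvd_diff cong_sym dvdE)
  then have "x = ell_norm n k" by (simp add: ell_norm_def)
  then show "x \<in> range (ell_norm n)" by blast
qed (auto simp: ell_norm_def cong_iff_dvd_diff)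

lemma cong_ell_norm: "[ell_norm n a = 1] (mod int n + 1)"
  using range_ell_norm by blast

lemma ell_norm_inj: "ell_norm n a = ell_norm n b \<longleftrightarrow> a = b"
  by (auto simp: ell_norm_def)

lemma not_cong_minus_1:
  assumes "n \<ge> 2"
  shows "\<not> [1 = -1] (mod int n + 1)"
proof
  assume "[1 = -1] (mod int n + 1)"
  then have "int n + 1 dvd 2" by (simp add: cong_iff_dvd_diff)
  then show False using assms zdvd_imp_le[of "int n + 1" 2] by simp
qed

lemma coprime_ell_norm: "coprime (ell_norm n a) (int n + 1)"
  using cong_ell_norm[of n a] cong_imp_coprime cong_sym coprime_1_left by blast

text \<open>
  The cofactor of \<open>\<Sigma>\<^sub>n(p)\<close> in \<open>\<Sigma>\<^sub>n(x)\<close> is congruent to \<open>1\<close> modulo \<open>n + 1\<close>, since both norms are;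
  so it is the norm of the element \<open>r\<close> with \<open>x = p \<circ>\<^sub>n r\<close>.
\<close>
lemma ell_principal_iff: "x \<in> ell_principal n p \<longleftrightarrow> ell_norm n p dvd ell_norm n x"
proof
  assume "ell_norm n p dvd ell_norm n x"
  then obtain k where k: "ell_norm n x = ell_norm n p * k" by blast
  have "[ell_norm n p * k = 1 * k] (mod int n + 1)"
    by (intro cong_mult cong_ell_norm cong_refl)
  then have "[k = 1] (mod int n + 1)"
    using cong_ell_norm[of n x] k by (metis cong_sym cong_trans mult_1)
  then obtain r where "k = ell_norm n r"
    using range_ell_norm by blast
  then have "x = ell_mult n p r"
    using k by (simp flip: ell_norm_mult add: ell_norm_inj)
  then show "x \<in> ell_principal n p" by (auto simp: ell_principal_def)
qed (auto simp: ell_principal_def ell_norm_mult)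

lemma ell_ideal_principal: "ell_ideal n (ell_principal n p)"
  by (auto simp: ell_ideal_def ell_principal_iff ell_norm_mult ell_norm_add intro!: dvd_sum)

lemma ell_unit_iff: "ell_unit n u \<longleftrightarrow> is_unit (ell_norm n u)"
proof -
  have "ell_unit n u \<longleftrightarrow> 0 \<in> ell_principal n u"
    by (auto simp: ell_unit_def ell_principal_def)
  then show ?thesis by (simp add: ell_principal_iff) (simp add: ell_norm_def)
qed

lemma ell_norm_representative:
  assumes "coprime N (int n + 1)"
  obtains a where "[ell_norm n a = x] (mod N)"
proof -
  obtain y where "[y = x] (mod N)" "[y = 1] (mod int n + 1)"
    using binary_chinese_remainder_int[OF assms] by blast
  moreover from this obtain a where "y = ell_norm n a"
    using range_ell_norm by blast
  ultimately show ?thesis using that by blast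
qed

text \<open>
  To pass from \<open>\<circ>\<^sub>n\<close>-primality to ordinary primality, arbitrary integers \<open>x\<close> and \<open>y\<close> are replaced
  modulo \<open>\<Sigma>\<^sub>n(p)\<close> by norms. The hypothesis \<open>n > 0\<close> excludes a norm equal to \<open>0\<close>.
\<close>
lemma ell_prime_iff_prime_norm:
  assumes "n > 0"
  shows "ell_prime n p \<longleftrightarrow> prime \<bar>ell_norm n p\<bar>"
proof
  assume p: "ell_prime n p"
  let ?N = "ell_norm n p"
  have "prime_elem ?N"
  proof (rule prime_elemI)
    show "?N \<noteq> 0" using coprime_ell_norm[of n p] assms by auto
    show "\<not> is_unit ?N" using p by (simp add: ell_prime_def ell_unit_iff)
    fix x y assume xy: "?N dvd x * y"
    obtain a b where a: "[ell_norm n a = x] (mod ?N)" and b: "[ell_norm n b = y] (mod ?N)"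
      using ell_norm_representative[OF coprime_ell_norm] by metis
    have "?N dvd ell_norm n (ell_mult n a b)"
      using cong_mult[OF a b] xy by (simp add: ell_norm_mult cong_dvd_iff)
    then have "?N dvd ell_norm n a \<or> ?N dvd ell_norm n b"
      using p by (auto simp: ell_prime_def ell_prime_ideal_def ell_principal_iff)
    then show "?N dvd x \<or> ?N dvd y"
      using a b by (simp add: cong_dvd_iff)
  qed
  then show "prime \<bar>?N\<bar>" by simp
next
  assume "prime \<bar>ell_norm n p\<bar>"
  then have p: "prime_elem (ell_norm n p)" by simp
  then have unit: "\<not> ell_unit n p"
    by (metis ell_unit_iff prime_elem_not_unit)
  \<comment> \<open>\<open>0\<close> is the identity of \<open>\<circ>\<^sub>n\<close>, so it lies in the principal ideal of units only.\<close>
  moreover have "0 \<notin> ell_principal n p"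
    using unit by (auto simp: ell_unit_def ell_principal_def) 
  ultimately show "ell_prime n p"
    using p by (auto simp: ell_prime_def ell_prime_ideal_def ell_ideal_principal
        ell_principal_iff ell_norm_mult prime_elem_dvd_mult_iff)
qed

lemma cong_pm1_abs_ell_norm: "cong_pm1 (int n + 1) \<bar>ell_norm n p\<bar>"
  using cong_ell_norm[of n p] cong_minus_minus_iff[of "ell_norm n p" 1]
  by (auto simp: cong_pm1_def abs_if)

lemma bij_betw_abs_ell_norm:
  assumes "n \<ge> 2"
  shows "bij_betw (\<lambda>p. \<bar>ell_norm n p\<bar>) UNIV {q. q \<ge> 0 \<and> cong_pm1 (int n + 1) q}"
  unfolding bij_betw_def
proof
  show "inj (\<lambda>p. \<bar>ell_norm n p\<bar>)"
  proof (rule injI)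
    fix a b assume "\<bar>ell_norm n a\<bar> = \<bar>ell_norm n b\<bar>"
    moreover have "ell_norm n a \<noteq> - ell_norm n b"
    proof
      assume "ell_norm n a = - ell_norm n b"
      then have "[1 = -1] (mod int n + 1)"
        using cong_ell_norm[of n a] cong_ell_norm[of n b]
        by (metis cong_minus_minus_iff cong_sym cong_trans)
      with not_cong_minus_1[OF assms] show False by contradiction
    qed
    ultimately show "a = b" by (simp add: abs_eq_iff ell_norm_inj)
  qed
  have "q \<in> range (\<lambda>p. \<bar>ell_norm n p\<bar>)" if "q \<ge> 0" "cong_pm1 (int n + 1) q" for q
  proof -
    have "q \<in> range (ell_norm n) \<or> -q \<in> range (ell_norm n)"
      using that(2) cong_minus_minus_iff[of q "-1"]
      by (auto simp: cong_pm1_def range_ell_norm)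
    then obtain p where "\<bar>ell_norm n p\<bar> = \<bar>q\<bar>"
      by (metis abs_minus_cancel imageE)
    then have "q = \<bar>ell_norm n p\<bar>" using that(1) by simp
    then show ?thesis by blast
  qed
  then show "range (\<lambda>p. \<bar>ell_norm n p\<bar>) = {q. q \<ge> 0 \<and> cong_pm1 (int n + 1) q}"
    by (auto simp: cong_pm1_abs_ell_norm)
qed

theorem theorem7p2:
  fixes n :: nat
  assumes "n \<ge> 2"
  shows "(\<forall>p. ell_prime n p \<longleftrightarrow>
             prime \<bar>ell_norm n p\<bar> \<and> cong_pm1 (int n + 1) \<bar>ell_norm n p\<bar>) \<and>
         bij_betw (\<lambda>p. \<bar>ell_norm n p\<bar>) {p. ell_prime n p}
           {q::int. prime q \<and> cong_pm1 (int n + 1) q} \<and>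
         (infinite {p. ell_prime n p} \<longleftrightarrow>
            infinite {q::int. prime q \<and> cong_pm1 (int n + 1) q}) \<and>
         infinite {q::int. prime q \<and> cong_pm1 (int n + 1) q} \<and>
         infinite {p. ell_prime n p}"
proof -
  let ?Q = "{q::int. prime q \<and> cong_pm1 (int n + 1) q}"
  have iff: "ell_prime n p \<longleftrightarrow>
      prime \<bar>ell_norm n p\<bar> \<and> cong_pm1 (int n + 1) \<bar>ell_norm n p\<bar>" for p
    using assms by (simp add: ell_prime_iff_prime_norm cong_pm1_abs_ell_norm)
  have "(\<lambda>p. \<bar>ell_norm n p\<bar>) ` {p. ell_prime n p} = ?Q"
  proof
    show "?Q \<subseteq> (\<lambda>p. \<bar>ell_norm n p\<bar>) ` {p. ell_prime n p}"
    proof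
      fix q :: int assume q: "q \<in> ?Q"
      then have "q \<in> range (\<lambda>p. \<bar>ell_norm n p\<bar>)"
        using bij_betw_abs_ell_norm[OF assms] prime_ge_0_int[of q] by (simp add: bij_betw_def)
      with q show "q \<in> (\<lambda>p. \<bar>ell_norm n p\<bar>) ` {p. ell_prime n p}"
        by (auto simp: iff)
    qed
  qed (auto simp: iff)
  then have bij: "bij_betw (\<lambda>p. \<bar>ell_norm n p\<bar>) {p. ell_prime n p} ?Q"
    using bij_betw_abs_ell_norm[OF assms] by (auto simp: bij_betw_def intro: inj_on_subset)
  have "int ` {q. prime q \<and> [q = 1] (mod Suc n)} \<subseteq> ?Q"
    by (auto simp: cong_pm1_def simp flip: cong_int_iff) (simp_all add: add.commute)
  moreover have "infinite (int ` {q. prime q \<and> [q = 1] (mod Suc n)})"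
    using infinite_primes_cong_1[of "Suc n"] by (simp add: finite_image_iff)
  ultimately have "infinite ?Q"
    using finite_subset by blast
  with bij iff show ?thesis
    by (auto dest: bij_betw_finite)
qed

end
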